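(* For any amenable group $G$ we have $d^*=\sigma_R=\sigma^R=\hat\sigma_R=\hat\sigma^R$, i.e. $d^*(A)=\sigma_R(A)=\sigma^R(A)=\hat\sigma_R(A)=\hat\sigma^R(A)$ for every subset $A\subset G$.
   Context: A group $G$ is amenable if it admits a left-invariant finitely additive probability measure defined on all subsets of $G$. $[G]^{<\omega}$ denotes the family of all non-empty finite subsets of $G$, and $P_\omega(G)$ the set of all finitely supported probability measures on $G$ (convex combinations of Dirac measures). For $A\subset G$ define $\sigma^R(A)=\inf_{F\in[G]^{<\omega}}\sup_{y\in G}\frac{|F\cap Ay|}{|F|}$ and $\sigma_R(A)=\inf_{\mu\in P_\omega(G)}\sup_{y\in G}\mu(Ay)$. For a function $\mu:\mathcal P(G)\to[0,1]$ that is monotone with $\mu(\emptyset)=0$ and $\mu(G)=1$, its subadditivization is $\hat\mu(A)=\sup_{B\subset G}\big(\mu(A\cup B)-\mu(B)\big)$; $\hat\sigma_R$ and $\hat\sigma^R$ are the subadditivizations of $\sigma_R$ and $\sigma^R$. The upper Banach density of $A\subset G$ is $$d^*(A)=\sup\Big\{\alpha\in[0,1]:\forall F\in[G]^{<\omega}\ \forall\varepsilon>0\ \exists K\in[G]^{<\omega}\text{ such that }\max_{x\in F}\tfrac{|xK\triangle K|}{|K|}<\varepsilon\text{ and }\tfrac{|K\cap A|}{|K|}\ge\alpha\Big\},$$ where $\triangle$ denotes symmetric difference. *)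

theory Defs
  imports "HOL-Algebra.Coset" "HOL-Probability.Probability_Mass_Function"
begin

definition amenable_group :: "('a, 'b) monoid_scheme \<Rightarrow> bool" where
  "amenable_group G \<longleftrightarrow> group G \<and>
     (\<exists>m :: 'a set \<Rightarrow> real.
        (\<forall>A\<subseteq>carrier G. 0 \<le> m A) \<and>
        m (carrier G) = 1 \<and>
        Measure_Space.additive (Pow (carrier G)) m \<and>
        (\<forall>g\<in>carrier G. \<forall>A\<subseteq>carrier G. m (g <#\<^bsub>G\<^esub> A) = m A))"

definition fin_subsets :: "('a, 'b) monoid_scheme \<Rightarrow> 'a set set" where
  "fin_subsets G = {F. F \<subseteq> carrier G \<and> finite F \<and> F \<noteq> {}}"

text \<open>Finitely supported probability measures on \<open>G\<close> are represented by their
  probability mass functions.\<close>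

definition fin_supp_pmfs :: "('a, 'b) monoid_scheme \<Rightarrow> 'a pmf set" where
  "fin_supp_pmfs G = {p. finite (set_pmf p) \<and> set_pmf p \<subseteq> carrier G}"

text \<open>All infima and suprema below are taken in \<open>real\<close>. If \<open>G\<close> is a group, those in
  \<open>sigma_up\<close> and \<open>sigma_low\<close>, and the supremum in \<open>subadditivization\<close> of either of them,
  range over nonempty subsets of \<open>[-1, 1]\<close>.\<close>

definition sigma_up :: "('a, 'b) monoid_scheme \<Rightarrow> 'a set \<Rightarrow> real" where
  "sigma_up G A =
     (INF F\<in>fin_subsets G. SUP y\<in>carrier G. real (card (F \<inter> (A #>\<^bsub>G\<^esub> y))) / real (card F))"

definition sigma_low :: "('a, 'b) monoid_scheme \<Rightarrow> 'a set \<Rightarrow> real" where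
  "sigma_low G A =
     (INF p\<in>fin_supp_pmfs G. SUP y\<in>carrier G. measure_pmf.prob p (A #>\<^bsub>G\<^esub> y))"

definition subadditivization ::
    "('a, 'b) monoid_scheme \<Rightarrow> ('a set \<Rightarrow> real) \<Rightarrow> 'a set \<Rightarrow> real" where
  "subadditivization G \<mu> A = (SUP B\<in>Pow (carrier G). \<mu> (A \<union> B) - \<mu> B)"

text \<open>The set of admissible \<open>\<alpha>\<close> contains \<open>0\<close> exactly when \<open>G\<close> has almost invariant finite
  sets; otherwise it is empty and the value of \<open>Sup\<close> carries no meaning.\<close>

definition upper_banach_density :: "('a, 'b) monoid_scheme \<Rightarrow> 'a set \<Rightarrow> real" where
  "upper_banach_density G A =
     Sup {\<alpha>\<in>{0..1}. \<forall>F\<in>fin_subsets G. \<forall>\<epsilon>>0. \<exists>K\<in>fin_subsets G.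
            Max ((\<lambda>x. real (card (sym_diff (x <#\<^bsub>G\<^esub> K) K)) / real (card K)) ` F) < \<epsilon> \<and>
            real (card (K \<inter> A)) / real (card K) \<ge> \<alpha>}"

end

theory Submission
  imports Defs
begin

text \<open>Everything rests on one consequence of amenability, Folner's condition: for every finite
  \<open>F\<close> and \<open>\<epsilon> > 0\<close> there is a nonempty finite \<open>K\<close> with \<open>|xK \<triangle> K| < \<epsilon>|K|\<close> for all \<open>x\<close> in
  \<open>F\<close>. It is what makes the set of densities in the definition of \<open>d\<^sup>*\<close> nonempty.

  Given Folner's condition, the densities agree because of a cycle of inequalities
  \<open>d\<^sup>* \<le> \<sigma>\<^sub>R \<le> \<sigma>\<^sup>R \<le> d\<^sup>*\<close>. The first is double counting: if \<open>K\<close> is almost invariant under the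
  support of \<open>\<mu>\<close>, then the average of \<open>\<mu>(Ak\<^sup>-\<^sup>1)\<close> over \<open>k \<in> K\<close> is the \<open>\<mu>\<close>-average of
  \<open>|xK \<inter> A|/|K|\<close>, which is almost \<open>|K \<inter> A|/|K|\<close>
  (\<open>average_translate_measure\<close>). The second holds since uniform measures are finitely
  supported. For the third, some \<open>y\<close> gives \<open>|K \<inter> Ay|/|K| \<ge> \<sigma>\<^sup>R(A)\<close>, and the right translate
  \<open>Ky\<^sup>-\<^sup>1\<close> is as invariant under left translations as \<open>K\<close> and meets \<open>A\<close> in that proportion
  (\<open>sigma_up_le_upper_banach_density\<close>). Finally \<open>d\<^sup>*\<close> is subadditive, because conditions
  bounding the density of \<open>A\<close> and that of \<open>B\<close> in almost invariant sets can be imposed on one and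
  the same set; and a subadditive function that vanishes at \<open>{}\<close> is its own subadditivization.

  Folner's condition is proved by contraposition (\<open>amenable_group_folner_condition\<close>). If it
  fails, some finite \<open>T\<close> satisfies \<open>|TK| \<ge> (1 + \<epsilon>/2)|K|\<close> for every finite \<open>K\<close>; a power \<open>S\<close> of
  \<open>T\<close> then satisfies \<open>|SK| \<ge> 2|K|\<close>. By Hall's marriage theorem for infinite families of finite
  sets there are two injections of \<open>G\<close> into itself with disjoint images, both moving each \<open>g\<close> to
  some \<open>sg\<close> with \<open>s \<in> S\<close>. Such a map is a translation on each of finitely many pieces, so an
  invariant mean gives its image measure \<open>1\<close>, and the two images would have total measure \<open>2\<close>.\<close>

(* Without the multiset order, the symbol denotes left cosets unambiguously. *)
no_notation subset_mset (infix \<open><#\<close> 50)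

section \<open>Hall's theorem for infinite families of finite sets\<close>

text \<open>A family of sets indexed by \<open>I\<close> is encoded as a relation, so that thinning out the members of
  the family is passing to a smaller relation, and Zorn's lemma applies to the sets of removed pairs.\<close>

definition hall_condition :: "'i set \<Rightarrow> ('i \<times> 'x) set \<Rightarrow> bool" where
  "hall_condition I R \<longleftrightarrow> (\<forall>J\<subseteq>I. finite J \<longrightarrow> card J \<le> card (R `` J))"

text \<open>The union of a chain of removable sets of pairs is removable: Hall's inequality for a finite
  \<open>J\<close> concerns only the finitely many pairs of \<open>R\<close> over \<open>J\<close>, and the part of the union among these
  is already contained in one member of the chain. Finiteness of the sets \<open>R `` {i}\<close> is essential
  here.\<close>

lemma minimal_hall_relation_exists:
  assumes fin: "\<And>i. i \<in> I \<Longrightarrow> finite (R `` {i})"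
    and hall: "hall_condition I R"
  obtains R' where "R' \<subseteq> R" "hall_condition I R'"
    "\<And>z. z \<in> R' \<Longrightarrow> \<not> hall_condition I (R' - {z})"
proof -
  define \<D> where "\<D> = {D. D \<subseteq> R \<and> hall_condition I (R - D)}"
  have "\<exists>U\<in>\<D>. \<forall>X\<in>\<C>. X \<subseteq> U" if ch: "subset.chain \<D> \<C>" for \<C>
  proof (cases "\<C> = {}")
    case True
    with hall show ?thesis by (intro bexI[of _ "{}"]) (auto simp: \<D>_def)
  next
    case False
    have sub: "\<C> \<subseteq> \<D>" using ch by (simp add: subset.chain_def)
    have "card J \<le> card ((R - \<Union>\<C>) `` J)" if J: "J \<subseteq> I" "finite J" for J
    proof -
      have "finite (R \<inter> J \<times> UNIV)"
      proof (rule finite_subset)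
        show "R \<inter> J \<times> UNIV \<subseteq> (\<Union>i\<in>J. {i} \<times> R `` {i})" by auto
        show "finite (\<Union>i\<in>J. {i} \<times> R `` {i})" using J fin by auto
      qed
      then have "finite (\<Union>\<C> \<inter> (R \<inter> J \<times> UNIV))" by auto
      then obtain D where D: "D \<in> \<C>" "\<Union>\<C> \<inter> (R \<inter> J \<times> UNIV) \<subseteq> D"
        using finite_subset_Union_chain[OF _ _ False ch] by (metis inf_le1)
      then have "(R - \<Union>\<C>) `` J = (R - D) `` J" by blast
      moreover have "hall_condition I (R - D)" using D sub by (auto simp: \<D>_def)
      ultimately show ?thesis using J by (simp add: hall_condition_def)
    qed
    then have "\<Union>\<C> \<in> \<D>" using sub by (auto simp: \<D>_def hall_condition_def)
    then show ?thesis by blast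
  qed
  then obtain M where M: "M \<in> \<D>" and max: "\<And>X. X \<in> \<D> \<Longrightarrow> M \<subseteq> X \<Longrightarrow> X = M"
    using subset_Zorn'[of \<D>] subset_Zorn[of \<D>] by metis
  show thesis
  proof
    show "R - M \<subseteq> R" by blast
    show "hall_condition I (R - M)" using M by (simp add: \<D>_def)
    show "\<not> hall_condition I (R - M - {z})" if "z \<in> R - M" for z
    proof
      assume "hall_condition I (R - M - {z})"
      moreover have "R - M - {z} = R - insert z M" by blast
      ultimately have "insert z M \<in> \<D>" using M that by (auto simp: \<D>_def)
      with max that show False by blast
    qed
  qed
qed

text \<open>Rado's argument. If \<open>i\<close> had two partners \<open>x\<close> and \<open>y\<close>, then by minimality the removal of either
  pair violates Hall's inequality, at \<open>J \<union> {i}\<close> and \<open>K \<union> {i}\<close> say. The corresponding images \<open>P\<close>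
  and \<open>Q\<close> satisfy \<open>|P| \<le> |J|\<close> and \<open>|Q| \<le> |K|\<close>, whereas Hall's inequality for \<open>J \<union> K \<union> {i}\<close>
  and for \<open>J \<inter> K\<close> gives \<open>|P| + |Q| = |P \<union> Q| + |P \<inter> Q| \<ge> |J| + |K| + 1\<close>.\<close>

lemma minimal_hall_relation_functional:
  assumes fin: "\<And>i. i \<in> I \<Longrightarrow> finite (R `` {i})"
    and hall: "hall_condition I R"
    and minimal: "\<And>z. z \<in> R \<Longrightarrow> \<not> hall_condition I (R - {z})"
    and i: "i \<in> I" and x: "(i, x) \<in> R" and y: "(i, y) \<in> R"
  shows "x = y"
proof (rule ccontr)
  assume ne: "x \<noteq> y"
  have fin': "finite (R `` J)" if "J \<subseteq> I" "finite J" for J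
  proof -
    have "R `` J = (\<Union>i\<in>J. R `` {i})" by blast
    then show ?thesis using that fin by auto
  qed
  have violation: "\<exists>J\<subseteq>I. finite J \<and> i \<notin> J \<and> card (R `` J \<union> (R `` {i} - {u})) \<le> card J"
    if u: "(i, u) \<in> R" for u
  proof -
    obtain J where J: "J \<subseteq> I" "finite J" "card ((R - {(i, u)}) `` J) < card J"
      using minimal[OF u] by (auto simp: hall_condition_def not_le)
    have "i \<in> J"
    proof (rule ccontr)
      assume "i \<notin> J"
      then have "(R - {(i, u)}) `` J = R `` J" by blast
      with J hall show False by (auto simp: hall_condition_def)
    qed
    have "R `` (J - {i}) \<union> (R `` {i} - {u}) \<subseteq> (R - {(i, u)}) `` J" using \<open>i \<in> J\<close> by blast
    moreover have "finite ((R - {(i, u)}) `` J)"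
      using fin'[OF J(1,2)] by (rule finite_subset[rotated]) blast
    ultimately have "card (R `` (J - {i}) \<union> (R `` {i} - {u})) < card J"
      using J(3) card_mono by (metis le_less_trans)
    then show ?thesis using J \<open>i \<in> J\<close>
      by (intro exI[of _ "J - {i}"]) auto
  qed
  obtain J where J: "J \<subseteq> I" "finite J" "i \<notin> J" "card (R `` J \<union> (R `` {i} - {x})) \<le> card J"
    using violation[OF x] by blast
  obtain K where K: "K \<subseteq> I" "finite K" "i \<notin> K" "card (R `` K \<union> (R `` {i} - {y})) \<le> card K"
    using violation[OF y] by blast
  define P where "P = R `` J \<union> (R `` {i} - {x})"
  define Q where "Q = R `` K \<union> (R `` {i} - {y})"
  have finPQ: "finite P" "finite Q" using J(1,2) K(1,2) fin' fin[OF i] by (auto simp: P_def Q_def)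
  have "card (J \<union> K) + 1 = card (insert i (J \<union> K))" using J(2,3) K(2,3) by simp
  also have "\<dots> \<le> card (R `` insert i (J \<union> K))"
    using hall i J(1,2) K(1,2) by (simp add: hall_condition_def)
  \<comment> \<open>As \<open>x\<close> and \<open>y\<close> differ, each is missing from only one of the two sets.\<close>
  also have "R `` insert i (J \<union> K) = P \<union> Q" using ne by (auto simp: P_def Q_def)
  finally have union: "card (J \<union> K) + 1 \<le> card (P \<union> Q)" .
  have "card (J \<inter> K) \<le> card (R `` (J \<inter> K))"
    using hall J(1,2) K(2) by (simp add: hall_condition_def le_infI1)
  also have "\<dots> \<le> card (P \<inter> Q)"
    using finPQ by (intro card_mono) (auto simp: P_def Q_def)
  finally have "card (J \<inter> K) \<le> card (P \<inter> Q)" .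
  with union J(4) K(4) card_Un_Int[OF J(2) K(2)] card_Un_Int[OF finPQ]
  show False by (simp add: P_def Q_def)
qed

text \<open>In a minimal relation satisfying Hall's condition each index has exactly one partner, and Hall's
  inequality for two-element sets says that distinct indices have distinct partners.\<close>

theorem hall_injection_exists:
  assumes fin: "\<And>i. i \<in> I \<Longrightarrow> finite (X i)"
    and hall: "\<And>J. J \<subseteq> I \<Longrightarrow> finite J \<Longrightarrow> card J \<le> card (\<Union>i\<in>J. X i)"
  obtains f where "inj_on f I" "\<And>i. i \<in> I \<Longrightarrow> f i \<in> X i"
proof -
  define R where "R = (SIGMA i:I. X i)"
  have image: "R `` J = (\<Union>i\<in>J. X i)" if "J \<subseteq> I" for J using that by (auto simp: R_def)
  have finR: "finite (R `` {i})" if "i \<in> I" for i using fin[OF that] that by (simp add: image)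
  have "hall_condition I R" using hall by (simp add: hall_condition_def image)
  then obtain R' where R': "R' \<subseteq> R" "hall_condition I R'"
      "\<And>z. z \<in> R' \<Longrightarrow> \<not> hall_condition I (R' - {z})"
    using minimal_hall_relation_exists[of I R] finR by metis
  have finR': "finite (R' `` {i})" if "i \<in> I" for i
    using finR[OF that] R'(1) by (meson Image_mono finite_subset order_refl)
  have "\<exists>x. R' `` {i} = {x}" if i: "i \<in> I" for i
  proof -
    have "card {i} \<le> card (R' `` {i})"
      using R'(2) i unfolding hall_condition_def by blast
    then have "R' `` {i} \<noteq> {}" by (intro notI) simp
    then obtain x where "(i, x) \<in> R'" by blast
    then show ?thesis
      using minimal_hall_relation_functional[OF finR' R'(2,3) i] by blast
  qed
  then obtain f where f: "\<And>i. i \<in> I \<Longrightarrow> R' `` {i} = {f i}" by metis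
  show thesis
  proof
    show "f i \<in> X i" if "i \<in> I" for i using f[OF that] R'(1) by (auto simp: R_def)
    show "inj_on f I"
    proof (rule inj_onI)
      fix i j assume ij: "i \<in> I" "j \<in> I" "f i = f j"
      have "R' `` {i, j} = R' `` {i} \<union> R' `` {j}" by blast
      also have "\<dots> = {f i}" using f[OF ij(1)] f[OF ij(2)] ij(3) by simp
      finally have "card (R' `` {i, j}) = 1" by simp
      moreover have "card {i, j} \<le> card (R' `` {i, j})"
        using R'(2) ij(1,2) by (simp add: hall_condition_def)
      ultimately have "card {i, j} \<le> 1" by simp
      then show "i = j" by (cases "i = j") auto
    qed
  qed
qed

section \<open>Amenable groups have almost invariant finite sets\<close>

definition almost_invariant ::
    "('a, 'b) monoid_scheme \<Rightarrow> 'a set \<Rightarrow> real \<Rightarrow> 'a set \<Rightarrow> bool" where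
  "almost_invariant G F \<epsilon> K \<longleftrightarrow> K \<in> fin_subsets G \<and>
     (\<forall>x\<in>F. real (card (sym_diff (x <#\<^bsub>G\<^esub> K) K)) < \<epsilon> * real (card K))"

definition folner_condition :: "('a, 'b) monoid_scheme \<Rightarrow> bool" where
  "folner_condition G \<longleftrightarrow> (\<forall>F\<in>fin_subsets G. \<forall>\<epsilon>>0. \<exists>K. almost_invariant G F \<epsilon> K)"

lemma l_coset_eq_image: "x <#\<^bsub>G\<^esub> K = (\<lambda>k. x \<otimes>\<^bsub>G\<^esub> k) ` K"
  by (auto simp: l_coset_def)

lemma r_coset_eq_image: "K #>\<^bsub>G\<^esub> x = (\<lambda>k. k \<otimes>\<^bsub>G\<^esub> x) ` K"
  by (auto simp: r_coset_def)

lemma finite_set_mult: "finite S \<Longrightarrow> finite K \<Longrightarrow> finite (S <#>\<^bsub>G\<^esub> K)"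
  by (simp add: set_mult_def)

lemma (in group) card_l_coset:
  assumes "x \<in> carrier G" "K \<subseteq> carrier G"
  shows "card (x <# K) = card K"
  unfolding l_coset_eq_image
  using assms by (intro card_image inj_onI) (auto simp: subset_iff)

text \<open>Since \<open>xK\<close> and \<open>K\<close> have equal size, half of their symmetric difference lies outside \<open>K\<close>.
  Adjoining \<open>\<one>\<close> to \<open>F\<close> keeps \<open>K\<close> itself inside the product.\<close>

lemma (in group) expansion_if_no_almost_invariant:
  assumes F: "F \<subseteq> carrier G" "finite F"
    and no: "\<And>K. \<not> almost_invariant G F \<epsilon> K"
    and K: "K \<subseteq> carrier G" "finite K"
  shows "(1 + \<epsilon> / 2) * real (card K) \<le> real (card (insert \<one> F <#> K))"
proof (cases "K = {}")
  case True
  then show ?thesis by simp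
next
  case False
  then obtain x where x: "x \<in> F" "\<epsilon> * real (card K) \<le> real (card (sym_diff (x <# K) K))"
    using no[of K] K by (auto simp: almost_invariant_def fin_subsets_def not_less)
  have xG: "x \<in> carrier G" using x F by blast
  have fin: "finite (x <# K)" using K by (simp add: l_coset_eq_image)
  have "card ((x <# K) - K) = card (K - (x <# K))"
    using card_l_coset[OF xG K(1)] fin K(2)
    by (metis card_Diff_subset_Int Int_commute finite_Int)
  moreover have "card (sym_diff (x <# K) K) = card ((x <# K) - K) + card (K - (x <# K))"
    using fin K(2) by (intro card_Un_disjoint) auto
  ultimately have half: "\<epsilon> / 2 * real (card K) \<le> real (card ((x <# K) - K))"
    using x(2) by simp
  have "K \<union> ((x <# K) - K) \<subseteq> insert \<one> F <#> K"
  proof -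
    have "K \<subseteq> insert \<one> F <#> K"
    proof
      fix k assume k: "k \<in> K"
      then have "k = \<one> \<otimes> k" using K by auto
      then show "k \<in> insert \<one> F <#> K" using k unfolding set_mult_def by blast
    qed
    moreover have "x <# K \<subseteq> insert \<one> F <#> K" using x by (auto simp: l_coset_def set_mult_def)
    ultimately show ?thesis by blast
  qed
  then have "card (K \<union> ((x <# K) - K)) \<le> card (insert \<one> F <#> K)"
    using F K by (intro card_mono finite_set_mult) auto
  moreover have "card (K \<union> ((x <# K) - K)) = card K + card ((x <# K) - K)"
    using fin K(2) by (intro card_Un_disjoint) auto
  ultimately show ?thesis using half by (simp add: algebra_simps)
qed

lemma (in group) expansion_iterate:
  assumes T: "T \<subseteq> carrier G" "finite T" and "0 \<le> c"
    and expand: "\<And>K. K \<subseteq> carrier G \<Longrightarrow> finite K \<Longrightarrow> c * real (card K) \<le> real (card (T <#> K))"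
  shows "\<exists>S\<subseteq>carrier G. finite S \<and>
    (\<forall>K\<subseteq>carrier G. finite K \<longrightarrow> c ^ n * real (card K) \<le> real (card (S <#> K)))"
proof (induction n)
  case 0
  have "{\<one>} <#> K = K" if "K \<subseteq> carrier G" for K
    using that by (force simp: set_mult_def)
  then show ?case by (intro exI[of _ "{\<one>}"]) auto
next
  case (Suc n)
  then obtain S where S: "S \<subseteq> carrier G" "finite S"
    and exp: "\<And>K. K \<subseteq> carrier G \<Longrightarrow> finite K \<Longrightarrow> c ^ n * real (card K) \<le> real (card (S <#> K))"
    by blast
  have "c ^ Suc n * real (card K) \<le> real (card ((S <#> T) <#> K))"
    if K: "K \<subseteq> carrier G" "finite K" for K
  proof -
    have "c ^ Suc n * real (card K) = c ^ n * (c * real (card K))" by simp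
    also have "\<dots> \<le> c ^ n * real (card (T <#> K))"
      using expand[OF K] \<open>0 \<le> c\<close> by (intro mult_left_mono) auto
    also have "\<dots> \<le> real (card (S <#> (T <#> K)))"
      using K T by (intro exp set_mult_closed finite_set_mult)
    finally show ?thesis using set_mult_assoc[OF S(1) T(1) K(1)] by simp
  qed
  then show ?case using S T
    by (intro exI[of _ "S <#> T"]) (simp add: set_mult_closed finite_set_mult)
qed

text \<open>Hall's theorem is applied to two copies of \<open>G\<close>, the sets of admissible partners being \<open>Sg\<close> for
  both copies of \<open>g\<close>: a finite set \<open>J\<close> of indices has at most twice as many elements as its
  projection to \<open>G\<close>, so doubling is precisely Hall's condition.\<close>

lemma (in group) two_disjoint_displacements:
  assumes S: "S \<subseteq> carrier G" "finite S"
    and double: "\<And>K. K \<subseteq> carrier G \<Longrightarrow> finite K \<Longrightarrow> 2 * card K \<le> card (S <#> K)"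
  obtains \<phi> \<psi> where
    "inj_on \<phi> (carrier G)" "inj_on \<psi> (carrier G)" "\<phi> ` carrier G \<inter> \<psi> ` carrier G = {}"
    "\<And>g. g \<in> carrier G \<Longrightarrow> \<exists>s\<in>S. \<phi> g = s \<otimes> g"
    "\<And>g. g \<in> carrier G \<Longrightarrow> \<exists>s\<in>S. \<psi> g = s \<otimes> g"
proof -
  define I where "I = carrier G \<times> (UNIV :: bool set)"
  have hall: "card J \<le> card (\<Union>i\<in>J. (\<lambda>s. s \<otimes> fst i) ` S)" if J: "J \<subseteq> I" "finite J" for J
  proof -
    have "J \<subseteq> fst ` J \<times> UNIV" by force
    then have "card J \<le> card (fst ` J \<times> (UNIV :: bool set))"
      using J(2) by (intro card_mono) auto
    also have "\<dots> = 2 * card (fst ` J)" by (simp add: card_cartesian_product)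
    also have "\<dots> \<le> card (S <#> fst ` J)" using J by (intro double) (auto simp: I_def)
    also have "S <#> fst ` J = (\<Union>i\<in>J. (\<lambda>s. s \<otimes> fst i) ` S)" by (auto simp: set_mult_def)
    finally show ?thesis .
  qed
  obtain f where f: "inj_on f I" "\<And>i. i \<in> I \<Longrightarrow> f i \<in> (\<lambda>s. s \<otimes> fst i) ` S"
  proof (rule hall_injection_exists[of I "\<lambda>i. (\<lambda>s. s \<otimes> fst i) ` S"])
    show "finite ((\<lambda>s. s \<otimes> fst i) ` S)" for i :: "'a \<times> bool" using S(2) by simp
  qed (use hall in simp_all)
  have inj: "g = h \<and> b = c" if "f (g, b) = f (h, c)" "g \<in> carrier G" "h \<in> carrier G" for g h b c
    using inj_onD[OF f(1), of "(g, b)" "(h, c)"] that by (simp add: I_def)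
  show thesis
  proof (rule that[of "\<lambda>g. f (g, False)" "\<lambda>g. f (g, True)"])
    show "inj_on (\<lambda>g. f (g, False)) (carrier G)" "inj_on (\<lambda>g. f (g, True)) (carrier G)"
      using inj by (blast intro: inj_onI)+
    show "(\<lambda>g. f (g, False)) ` carrier G \<inter> (\<lambda>g. f (g, True)) ` carrier G = {}"
      using inj by blast
    show "\<exists>s\<in>S. f (g, False) = s \<otimes> g" "\<exists>s\<in>S. f (g, True) = s \<otimes> g" if "g \<in> carrier G" for g
      using f(2)[of "(g, False)"] f(2)[of "(g, True)"] that by (auto simp: I_def)
  qed
qed

text \<open>A piecewise translation with pieces indexed by a finite set preserves every invariant mean. In
  the induction, the piece on which \<open>\<phi>\<close> is translation by \<open>s\<close> is split off, and the remaining
  elements are moved by members of the smaller set.\<close>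

lemma (in group) invariant_mean_piecewise_translation:
  fixes m :: "'a set \<Rightarrow> real"
  assumes add: "Measure_Space.additive (Pow (carrier G)) m"
    and inv: "\<And>g A. g \<in> carrier G \<Longrightarrow> A \<subseteq> carrier G \<Longrightarrow> m (g <# A) = m A"
    and "finite S" "S \<subseteq> carrier G" "B \<subseteq> carrier G" "inj_on \<phi> B"
    and "\<And>g. g \<in> B \<Longrightarrow> \<exists>s\<in>S. \<phi> g = s \<otimes> g"
  shows "m (\<phi> ` B) = m B"
  using assms(3-)
proof (induction S arbitrary: B rule: finite_induct)
  case empty
  then have "B = {}" by blast
  then show ?case by simp
next
  case (insert s S)
  define C where "C = {g \<in> B. \<phi> g = s \<otimes> g}"
  have closed: "\<phi> ` B \<subseteq> carrier G"
  proof
    fix y assume "y \<in> \<phi> ` B"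
    then obtain g where g: "g \<in> B" "y = \<phi> g" by blast
    then obtain t where "t \<in> insert s S" "\<phi> g = t \<otimes> g" using insert.prems by blast
    then show "y \<in> carrier G" using g insert.prems(1,2) by auto
  qed
  have "\<phi> ` C = s <# C" by (force simp: l_coset_eq_image C_def)
  moreover have "C \<subseteq> carrier G" using insert.prems(2) by (auto simp: C_def)
  ultimately have C: "m (\<phi> ` C) = m C" using insert.prems(1) by (simp add: inv)
  have D: "m (\<phi> ` (B - C)) = m (B - C)"
  proof (rule insert.IH)
    show "inj_on \<phi> (B - C)" using insert.prems(3) by (rule inj_on_subset) blast
    show "\<exists>t\<in>S. \<phi> g = t \<otimes> g" if "g \<in> B - C" for g
      using insert.prems(4)[of g] that by (auto simp: C_def)
  qed (use insert.prems in auto)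
  have CB: "C \<subseteq> B" by (auto simp: C_def)
  have "\<phi> ` C \<inter> \<phi> ` (B - C) = {}" using insert.prems(3) CB by (auto simp: inj_on_def)
  then have "m (\<phi> ` C \<union> \<phi> ` (B - C)) = m (\<phi> ` C) + m (\<phi> ` (B - C))"
    using closed image_mono[OF CB, of \<phi>] by (intro additiveD[OF add]) auto
  moreover have "m (C \<union> (B - C)) = m C + m (B - C)"
    using insert.prems(2) CB by (intro additiveD[OF add]) auto
  moreover have "\<phi> ` C \<union> \<phi> ` (B - C) = \<phi> ` B" "C \<union> (B - C) = B" using CB by auto
  ultimately show ?case using C D by simp
qed

text \<open>Otherwise the group contains two disjoint sets onto each of which it is mapped bijectively by a
  piecewise translation; an invariant mean would have to give both of them measure \<open>1\<close>.\<close>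

theorem amenable_group_folner_condition:
  fixes G (structure)
  assumes "amenable_group G"
  shows "folner_condition G"
proof (rule ccontr)
  interpret group G using assms by (simp add: amenable_group_def)
  obtain m :: "'a set \<Rightarrow> real" where nonneg: "\<forall>A\<subseteq>carrier G. 0 \<le> m A"
    and one: "m (carrier G) = 1"
    and add: "Measure_Space.additive (Pow (carrier G)) m"
    and "\<forall>g\<in>carrier G. \<forall>A\<subseteq>carrier G. m (g <# A) = m A"
    using assms unfolding amenable_group_def by metis
  then have inv: "m (g <# A) = m A" if "g \<in> carrier G" "A \<subseteq> carrier G" for g A
    using that by blast
  assume "\<not> folner_condition G"
  then obtain F \<epsilon> where F: "F \<subseteq> carrier G" "finite F" and "\<epsilon> > 0"
    and no: "\<And>K. \<not> almost_invariant G F \<epsilon> K"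
    by (auto simp: folner_condition_def fin_subsets_def)
  obtain n where n: "2 < (1 + \<epsilon> / 2) ^ n"
    using real_arch_pow[of "1 + \<epsilon> / 2" 2] \<open>\<epsilon> > 0\<close> by auto
  obtain S where S: "S \<subseteq> carrier G" "finite S" and expand:
    "\<And>K. K \<subseteq> carrier G \<Longrightarrow> finite K \<Longrightarrow> (1 + \<epsilon> / 2) ^ n * real (card K) \<le> real (card (S <#> K))"
    using expansion_iterate[of "insert \<one> F" "1 + \<epsilon> / 2" n]
      expansion_if_no_almost_invariant[OF F no] F \<open>\<epsilon> > 0\<close> by auto
  have "2 * card K \<le> card (S <#> K)" if "K \<subseteq> carrier G" "finite K" for K
  proof -
    have "2 * real (card K) \<le> (1 + \<epsilon> / 2) ^ n * real (card K)"
      using n by (intro mult_right_mono) auto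
    also have "\<dots> \<le> real (card (S <#> K))" using expand that .
    finally show ?thesis by linarith
  qed
  then obtain \<phi> \<psi> where inj: "inj_on \<phi> (carrier G)" "inj_on \<psi> (carrier G)"
    and disj: "\<phi> ` carrier G \<inter> \<psi> ` carrier G = {}"
    and disp: "\<And>g. g \<in> carrier G \<Longrightarrow> \<exists>s\<in>S. \<phi> g = s \<otimes> g"
      "\<And>g. g \<in> carrier G \<Longrightarrow> \<exists>s\<in>S. \<psi> g = s \<otimes> g"
    using two_disjoint_displacements[OF S] by metis
  define P where "P = \<phi> ` carrier G"
  define Q where "Q = \<psi> ` carrier G"
  have "\<phi> g \<in> carrier G" "\<psi> g \<in> carrier G" if "g \<in> carrier G" for g
    using disp[OF that] S(1) that by auto
  then have closed: "P \<subseteq> carrier G" "Q \<subseteq> carrier G" by (simp_all add: P_def Q_def image_subset_iff)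
  have "m P = 1"
    unfolding P_def one[symmetric]
    by (rule invariant_mean_piecewise_translation[where m = m and S = S and \<phi> = \<phi>])
      (use add inv S inj disp in simp_all)
  moreover have "m Q = 1"
    unfolding Q_def one[symmetric]
    by (rule invariant_mean_piecewise_translation[where m = m and S = S and \<phi> = \<psi>])
      (use add inv S inj disp in simp_all)
  moreover have "m (P \<union> Q) = m P + m Q"
    using closed disj by (intro additiveD[OF add]) (auto simp: P_def Q_def)
  moreover have "m ((P \<union> Q) \<union> (carrier G - (P \<union> Q))) = m (P \<union> Q) + m (carrier G - (P \<union> Q))"
    using closed by (intro additiveD[OF add]) auto
  moreover have "(P \<union> Q) \<union> (carrier G - (P \<union> Q)) = carrier G" using closed by blast
  moreover have "0 \<le> m (carrier G - (P \<union> Q))" using nonneg by (metis Diff_subset)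
  ultimately show False using one by simp
qed

section \<open>Equality and subadditivity of the densities\<close>

text \<open>The condition imposed on \<open>\<alpha>\<close> in the definition of the upper Banach density, with the maximum
  over \<open>F\<close> spelled out through \<open>almost_invariant\<close> and without the bound \<open>0 \<le> \<alpha> \<le> 1\<close>.\<close>

definition banach_admissible :: "('a, 'b) monoid_scheme \<Rightarrow> 'a set \<Rightarrow> real \<Rightarrow> bool" where
  "banach_admissible G A \<alpha> \<longleftrightarrow> (\<forall>F\<in>fin_subsets G. \<forall>\<epsilon>>0.
     \<exists>K. almost_invariant G F \<epsilon> K \<and> \<alpha> \<le> real (card (K \<inter> A)) / real (card K))"

lemma upper_banach_density_eq_Sup:
  "upper_banach_density G A = Sup {\<alpha>\<in>{0..1}. banach_admissible G A \<alpha>}"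
proof -
  have "almost_invariant G F \<epsilon> K \<longleftrightarrow> K \<in> fin_subsets G \<and>
      Max ((\<lambda>x. real (card (sym_diff (x <#\<^bsub>G\<^esub> K) K)) / real (card K)) ` F) < \<epsilon>"
    if F: "F \<in> fin_subsets G" for F \<epsilon> K
  proof (cases "K \<in> fin_subsets G")
    case True
    then have "0 < real (card K)" by (auto simp: fin_subsets_def card_gt_0_iff)
    with True F show ?thesis
      by (auto simp: almost_invariant_def fin_subsets_def divide_less_eq)
  qed (simp add: almost_invariant_def)
  then show ?thesis
    unfolding upper_banach_density_def banach_admissible_def
    by (intro arg_cong[where f = Sup]) (auto simp: Bex_def)
qed

lemma card_Int_ratio_le_one:
  assumes "finite K"
  shows "real (card (K \<inter> B)) / real (card K) \<le> 1"
  using card_mono[OF assms, of "K \<inter> B"] by (cases "card K = 0") (simp_all add: divide_le_eq_1)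

lemma almost_invariant_mono:
  "almost_invariant G F \<epsilon> K \<Longrightarrow> F' \<subseteq> F \<Longrightarrow> \<epsilon> \<le> \<epsilon>' \<Longrightarrow> almost_invariant G F' \<epsilon>' K"
  unfolding almost_invariant_def
  by (meson less_le_trans mult_right_mono of_nat_0_le_iff subsetD)

lemma banach_admissible_zero: "folner_condition G \<Longrightarrow> banach_admissible G A 0"
  unfolding folner_condition_def banach_admissible_def by simp

lemma banach_admissible_le_upper_banach_density:
  "banach_admissible G A \<alpha> \<Longrightarrow> \<alpha> \<in> {0..1} \<Longrightarrow> \<alpha> \<le> upper_banach_density G A"
  unfolding upper_banach_density_eq_Sup
  by (rule cSup_upper) (auto intro!: bdd_aboveI[of _ 1])

lemma upper_banach_density_least:
  assumes "folner_condition G"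
    and "\<And>\<alpha>. banach_admissible G A \<alpha> \<Longrightarrow> \<alpha> \<in> {0..1} \<Longrightarrow> \<alpha> \<le> c"
  shows "upper_banach_density G A \<le> c"
  unfolding upper_banach_density_eq_Sup
proof (rule cSup_least)
  have "0 \<in> {\<alpha> \<in> {0..1}. banach_admissible G A \<alpha>}"
    using banach_admissible_zero[OF assms(1)] by simp
  then show "{\<alpha> \<in> {0..1}. banach_admissible G A \<alpha>} \<noteq> {}" by blast
qed (use assms(2) in simp)

text \<open>A bound on the density is witnessed by a single pair \<open>(F, \<epsilon>)\<close>. This form of the definition
  lets bounds for two sets be combined.\<close>

lemma upper_banach_density_less_witness:
  assumes "group G" and folner: "folner_condition G"
    and less: "upper_banach_density G A < a"
  obtains F \<epsilon> where "F \<in> fin_subsets G" "\<epsilon> > 0"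
    "\<And>K. almost_invariant G F \<epsilon> K \<Longrightarrow> real (card (K \<inter> A)) < a * real (card K)"
proof -
  interpret group G by fact
  have pos: "0 < real (card K)" if "almost_invariant G F \<epsilon> K" for F \<epsilon> K
    using that by (auto simp: almost_invariant_def fin_subsets_def card_gt_0_iff)
  \<comment> \<open>A value above \<open>1\<close> is never admissible, so admissibility would put \<open>a\<close> into the set whose supremum is taken.\<close>
  have "\<not> banach_admissible G A a"
  proof
    assume adm: "banach_admissible G A a"
    have "{\<one>\<^bsub>G\<^esub>} \<in> fin_subsets G" by (simp add: fin_subsets_def)
    then obtain K where K: "almost_invariant G {\<one>\<^bsub>G\<^esub>} 1 K"
      "a \<le> real (card (K \<inter> A)) / real (card K)"
      using adm unfolding banach_admissible_def by (meson zero_less_one)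
    have "finite K" using K(1) by (simp add: almost_invariant_def fin_subsets_def)
    with K(2) have "a \<le> 1" by (meson card_Int_ratio_le_one order_trans)
    moreover have "0 \<le> upper_banach_density G A"
      using banach_admissible_le_upper_banach_density[OF banach_admissible_zero[OF folner]] by simp
    ultimately have "a \<le> upper_banach_density G A"
      using adm less by (intro banach_admissible_le_upper_banach_density) auto
    with less show False by simp
  qed
  then obtain F \<epsilon> where F: "F \<in> fin_subsets G" "\<epsilon> > 0"
    "\<And>K. almost_invariant G F \<epsilon> K \<Longrightarrow> \<not> a \<le> real (card (K \<inter> A)) / real (card K)"
    unfolding banach_admissible_def by blast
  then show thesis using that pos by (metis not_le pos_divide_less_eq)
qed

text \<open>An almost invariant set that meets \<open>A \<union> B\<close> in large proportion can be chosen to satisfy the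
  witnessing conditions for \<open>A\<close> and for \<open>B\<close> simultaneously. The submeasures \<open>\<sigma>\<^sub>R\<close> and \<open>\<sigma>\<^sup>R\<close> offer
  no such direct route, as a measure that is nearly optimal for \<open>A\<close> may be a poor choice for \<open>B\<close>.\<close>

lemma upper_banach_density_subadditive:
  assumes "group G" and folner: "folner_condition G"
  shows "upper_banach_density G (A \<union> B) \<le> upper_banach_density G A + upper_banach_density G B"
proof (rule field_le_epsilon)
  fix e :: real assume "e > 0"
  define a b where "a = upper_banach_density G A + e / 2" and "b = upper_banach_density G B + e / 2"
  obtain F \<epsilon> where F: "F \<in> fin_subsets G" "\<epsilon> > 0"
    "\<And>K. almost_invariant G F \<epsilon> K \<Longrightarrow> real (card (K \<inter> A)) < a * real (card K)"
    using upper_banach_density_less_witness[OF assms, of A a] \<open>e > 0\<close> by (auto simp: a_def)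
  obtain F' \<epsilon>' where F': "F' \<in> fin_subsets G" "\<epsilon>' > 0"
    "\<And>K. almost_invariant G F' \<epsilon>' K \<Longrightarrow> real (card (K \<inter> B)) < b * real (card K)"
    using upper_banach_density_less_witness[OF assms, of B b] \<open>e > 0\<close> by (auto simp: b_def)
  have "upper_banach_density G (A \<union> B) \<le> a + b"
  proof (rule upper_banach_density_least[OF folner])
    fix \<alpha> assume adm: "banach_admissible G (A \<union> B) \<alpha>"
    have "F \<union> F' \<in> fin_subsets G" using F F' by (auto simp: fin_subsets_def)
    then obtain K where K: "almost_invariant G (F \<union> F') (min \<epsilon> \<epsilon>') K"
      "\<alpha> \<le> real (card (K \<inter> (A \<union> B))) / real (card K)"
      using adm F(2) F'(2) unfolding banach_admissible_def by (meson min_less_iff_conj)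
    have pos: "0 < real (card K)"
      using K by (auto simp: almost_invariant_def fin_subsets_def card_gt_0_iff)
    have "card (K \<inter> (A \<union> B)) \<le> card (K \<inter> A) + card (K \<inter> B)"
      by (simp add: Int_Un_distrib card_Un_le)
    moreover have "real (card (K \<inter> A)) < a * real (card K)"
      using K(1) by (intro F(3)) (rule almost_invariant_mono, auto)
    moreover have "real (card (K \<inter> B)) < b * real (card K)"
      using K(1) by (intro F'(3)) (rule almost_invariant_mono, auto)
    moreover have "\<alpha> * real (card K) \<le> real (card (K \<inter> (A \<union> B)))"
      using K(2) pos by (simp add: pos_le_divide_eq)
    ultimately have "\<alpha> * real (card K) < (a + b) * real (card K)"
      by (simp add: distrib_right)
    then show "\<alpha> \<le> a + b" using pos by simp
  qed
  then show "upper_banach_density G (A \<union> B)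
      \<le> upper_banach_density G A + upper_banach_density G B + e"
    by (simp add: a_def b_def)
qed

lemma (in group) mem_r_coset_inv_iff:
  assumes "A \<subseteq> carrier G" "x \<in> carrier G" "k \<in> carrier G"
  shows "x \<in> A #> inv k \<longleftrightarrow> x \<otimes> k \<in> A"
proof
  assume "x \<in> A #> inv k"
  then obtain a where "a \<in> A" "x = a \<otimes> inv k" by (auto simp: r_coset_eq_image)
  then show "x \<otimes> k \<in> A" using assms by (auto simp: m_assoc)
next
  assume "x \<otimes> k \<in> A"
  moreover have "x = (x \<otimes> k) \<otimes> inv k" using assms by (simp add: m_assoc)
  ultimately show "x \<in> A #> inv k" by (auto simp: r_coset_eq_image)
qed

text \<open>Write \<open>\<mu>\<close> for \<open>p\<close> and count the pairs \<open>(x, k)\<close> with \<open>xk \<in> A\<close>, weighted by \<open>\<mu>(x)\<close>: for fixed \<open>k\<close> they make up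
  \<open>\<mu>(Ak\<^sup>-\<^sup>1)\<close>, and for fixed \<open>x\<close> their number is \<open>|xK \<inter> A|\<close>, which differs from \<open>|K \<inter> A|\<close> by at most
  \<open>|xK \<triangle> K|\<close>.\<close>

lemma (in group) average_translate_measure:
  assumes A: "A \<subseteq> carrier G" and p: "p \<in> fin_supp_pmfs G"
    and K: "almost_invariant G (set_pmf p) \<epsilon> K"
  shows "real (card (K \<inter> A)) - \<epsilon> * real (card K)
    \<le> (\<Sum>k\<in>K. measure_pmf.prob p (A #> inv k))"
proof -
  have fin: "finite (set_pmf p)" and supp: "set_pmf p \<subseteq> carrier G"
    using p by (auto simp: fin_supp_pmfs_def)
  have KG: "K \<subseteq> carrier G" "finite K"
    using K by (auto simp: almost_invariant_def fin_subsets_def)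
  have prob: "measure_pmf.prob p (A #> inv k) = (\<Sum>x\<in>set_pmf p. pmf p x * of_bool (x \<otimes> k \<in> A))"
    if k: "k \<in> K" for k
  proof -
    have "measure_pmf.prob p (A #> inv k) = measure_pmf.prob p ((A #> inv k) \<inter> set_pmf p)"
      by (simp add: measure_Int_set_pmf)
    also have "\<dots> = sum (pmf p) ((A #> inv k) \<inter> set_pmf p)"
      using fin by (intro measure_measure_pmf_finite) auto
    also have "(A #> inv k) \<inter> set_pmf p = {x \<in> set_pmf p. x \<otimes> k \<in> A}"
      using mem_r_coset_inv_iff[OF A] supp KG k by blast
    also have "sum (pmf p) \<dots> = (\<Sum>x\<in>set_pmf p. pmf p x * of_bool (x \<otimes> k \<in> A))"
      using fin by (simp add: sum.If_cases of_bool_def if_distrib Int_def cong: if_cong)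
    finally show ?thesis .
  qed
  have count: "real (card (K \<inter> A)) - \<epsilon> * real (card K) \<le> (\<Sum>k\<in>K. of_bool (x \<otimes> k \<in> A))"
    if x: "x \<in> set_pmf p" for x
  proof -
    have inj: "inj_on (\<lambda>k. x \<otimes> k) K" using x supp KG by (intro inj_onI) (auto simp: subset_iff)
    have "K \<inter> A \<subseteq> ((x <# K) \<inter> A) \<union> sym_diff (x <# K) K" by blast
    then have "card (K \<inter> A) \<le> card (((x <# K) \<inter> A) \<union> sym_diff (x <# K) K)"
      using KG by (intro card_mono) (auto simp: l_coset_eq_image)
    also have "\<dots> \<le> card ((x <# K) \<inter> A) + card (sym_diff (x <# K) K)" by (rule card_Un_le)
    also have "(x <# K) \<inter> A = (\<lambda>k. x \<otimes> k) ` {k \<in> K. x \<otimes> k \<in> A}"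
      by (auto simp: l_coset_eq_image)
    also have "card \<dots> = card {k \<in> K. x \<otimes> k \<in> A}"
      by (rule card_image) (rule inj_on_subset[OF inj], blast)
    finally have "card (K \<inter> A) \<le> card {k \<in> K. x \<otimes> k \<in> A} + card (sym_diff (x <# K) K)" .
    moreover have "real (card (sym_diff (x <# K) K)) < \<epsilon> * real (card K)"
      using K x by (simp add: almost_invariant_def)
    moreover have "real (card {k \<in> K. x \<otimes> k \<in> A}) = (\<Sum>k\<in>K. of_bool (x \<otimes> k \<in> A))"
      using KG(2) by (simp add: sum.If_cases of_bool_def Int_def)
    ultimately show ?thesis by linarith
  qed
  have "real (card (K \<inter> A)) - \<epsilon> * real (card K)
      = (\<Sum>x\<in>set_pmf p. pmf p x) * (real (card (K \<inter> A)) - \<epsilon> * real (card K))"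
    using fin by (simp add: sum_pmf_eq_1)
  also have "\<dots> \<le> (\<Sum>x\<in>set_pmf p. pmf p x * (\<Sum>k\<in>K. of_bool (x \<otimes> k \<in> A)))"
    unfolding sum_distrib_right by (intro sum_mono mult_left_mono count) auto
  also have "\<dots> = (\<Sum>k\<in>K. \<Sum>x\<in>set_pmf p. pmf p x * of_bool (x \<otimes> k \<in> A))"
    unfolding sum_distrib_left by (rule sum.swap)
  also have "\<dots> = (\<Sum>k\<in>K. measure_pmf.prob p (A #> inv k))" by (simp add: prob)
  finally show ?thesis .
qed

lemma (in group) banach_admissible_le_sup_translate:
  assumes A: "A \<subseteq> carrier G" and p: "p \<in> fin_supp_pmfs G"
    and adm: "banach_admissible G A \<alpha>"
  shows "\<alpha> \<le> (SUP y\<in>carrier G. measure_pmf.prob p (A #> y))" (is "_ \<le> ?s")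
proof (rule field_le_epsilon)
  fix \<epsilon> :: real assume "\<epsilon> > 0"
  have "set_pmf p \<in> fin_subsets G"
    using p set_pmf_not_empty by (auto simp: fin_supp_pmfs_def fin_subsets_def)
  then obtain K where K: "almost_invariant G (set_pmf p) \<epsilon> K"
    "\<alpha> \<le> real (card (K \<inter> A)) / real (card K)"
    using adm \<open>\<epsilon> > 0\<close> unfolding banach_admissible_def by blast
  have KG: "K \<subseteq> carrier G" and pos: "0 < real (card K)"
    using K(1) by (auto simp: almost_invariant_def fin_subsets_def card_gt_0_iff)
  have "(\<alpha> - \<epsilon>) * real (card K) \<le> real (card (K \<inter> A)) - \<epsilon> * real (card K)"
    using K(2) pos by (simp add: pos_le_divide_eq algebra_simps)
  also have "\<dots> \<le> (\<Sum>k\<in>K. measure_pmf.prob p (A #> inv k))"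
    by (rule average_translate_measure[OF A p K(1)])
  also have "\<dots> \<le> (\<Sum>k\<in>K. ?s)"
    using KG by (intro sum_mono cSUP_upper bdd_aboveI[of _ 1]) auto
  also have "\<dots> = ?s * real (card K)" by simp
  finally show "\<alpha> \<le> ?s + \<epsilon>" using pos by simp
qed

lemma upper_banach_density_le_sigma_low:
  assumes "group G" "folner_condition G" "A \<subseteq> carrier G"
  shows "upper_banach_density G A \<le> sigma_low G A"
proof -
  interpret group G by fact
  have "return_pmf \<one>\<^bsub>G\<^esub> \<in> fin_supp_pmfs G" by (simp add: fin_supp_pmfs_def)
  then show ?thesis
    unfolding sigma_low_def using assms banach_admissible_le_sup_translate
    by (intro upper_banach_density_least cINF_greatest) auto
qed

text \<open>The uniform measures on nonempty finite sets are among the finitely supported ones.\<close>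

lemma sigma_low_le_sigma_up:
  assumes "group G"
  shows "sigma_low G A \<le> sigma_up G A"
  unfolding sigma_up_def
proof (rule cINF_greatest)
  interpret group G by fact
  have "{\<one>\<^bsub>G\<^esub>} \<in> fin_subsets G" by (simp add: fin_subsets_def)
  then show "fin_subsets G \<noteq> {}" by blast
  fix F assume F: "F \<in> fin_subsets G"
  have "bdd_below ((\<lambda>p. SUP y\<in>carrier G. measure_pmf.prob p (A #>\<^bsub>G\<^esub> y)) ` fin_supp_pmfs G)"
    by (intro bdd_belowI2[of _ 0] cSUP_upper2[of _ _ "\<one>\<^bsub>G\<^esub>"] bdd_aboveI[of _ 1]) auto
  moreover have "pmf_of_set F \<in> fin_supp_pmfs G"
    using F by (simp add: fin_subsets_def fin_supp_pmfs_def)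
  ultimately have "sigma_low G A \<le> (SUP y\<in>carrier G. measure_pmf.prob (pmf_of_set F) (A #>\<^bsub>G\<^esub> y))"
    unfolding sigma_low_def by (rule cINF_lower)
  then show "sigma_low G A
      \<le> (SUP y\<in>carrier G. real (card (F \<inter> (A #>\<^bsub>G\<^esub> y))) / real (card F))"
    using F by (simp add: fin_subsets_def measure_pmf_of_set)
qed

text \<open>Left and right translations commute, so right translation maps \<open>xK \<triangle> K\<close> bijectively onto the
  symmetric difference belonging to the translate of \<open>K\<close>.\<close>

lemma (in group) almost_invariant_r_coset:
  assumes F: "F \<subseteq> carrier G" and K: "almost_invariant G F \<epsilon> K" and z: "z \<in> carrier G"
  shows "almost_invariant G F \<epsilon> (K #> z)" and "card (K #> z) = card K"
proof -
  have KG: "K \<subseteq> carrier G" "finite K" "K \<noteq> {}"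
    using K by (auto simp: almost_invariant_def fin_subsets_def)
  have inj: "inj_on (\<lambda>k. k \<otimes> z) (carrier G)" using z by (auto intro: inj_onI)
  have card_translate: "card (L #> z) = card L" if "L \<subseteq> carrier G" for L
    unfolding r_coset_eq_image using inj_on_subset[OF inj that] by (rule card_image)
  then show "card (K #> z) = card K" using KG by blast
  have "card (sym_diff (x <# (K #> z)) (K #> z)) = card (sym_diff (x <# K) K)" if x: "x \<in> F" for x
  proof -
    have xG: "x \<in> carrier G" using x F by blast
    have xK: "x <# K \<subseteq> carrier G" using xG KG(1) by (auto simp: l_coset_def)
    have "x <# (K #> z) = (x <# K) #> z"
      using coset_assoc[OF xG z KG(1)] by simp
    moreover have "(\<lambda>k. k \<otimes> z) ` sym_diff (x <# K) K
        = sym_diff ((\<lambda>k. k \<otimes> z) ` (x <# K)) ((\<lambda>k. k \<otimes> z) ` K)"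
      using inj_on_image_set_diff[OF inj, of "x <# K" K] inj_on_image_set_diff[OF inj, of K "x <# K"]
        xK KG(1) by (simp add: image_Un Diff_subset[THEN subset_trans])
    ultimately have "sym_diff (x <# (K #> z)) (K #> z) = sym_diff (x <# K) K #> z"
      by (simp add: r_coset_eq_image)
    then show ?thesis using card_translate[of "sym_diff (x <# K) K"] xK KG(1) by auto
  qed
  moreover have "K #> z \<in> fin_subsets G"
    using KG z by (auto simp: fin_subsets_def r_coset_eq_image)
  ultimately show "almost_invariant G F \<epsilon> (K #> z)"
    using K KG card_translate[of K] by (simp add: almost_invariant_def)
qed

text \<open>Only the finitely many values \<open>n/c\<close> with \<open>n \<le> |K|\<close> occur. Attainment makes \<open>\<sigma>\<^sup>R(A)\<close> itself an
  admissible density, with no loss of a further \<open>\<epsilon>\<close>.\<close>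

lemma sup_translate_density_attained:
  assumes "finite K" "Y \<noteq> {}"
  shows "\<exists>y\<in>Y. (SUP y\<in>Y. real (card (K \<inter> B y)) / c) = real (card (K \<inter> B y)) / c"
proof -
  let ?V = "(\<lambda>y. real (card (K \<inter> B y)) / c) ` Y"
  have "?V \<subseteq> (\<lambda>n. real n / c) ` {..card K}"
    using assms(1) by (auto intro!: imageI card_mono)
  then have "finite ?V" by (rule finite_subset) simp
  then have "Sup ?V \<in> ?V" using assms(2) Max_in[of ?V] by (simp add: cSup_eq_Max)
  then show ?thesis by auto
qed

text \<open>If \<open>K\<close> is almost invariant and \<open>|K \<inter> Ay| \<ge> \<sigma>\<^sup>R(A)|K|\<close>, then \<open>Ky\<^sup>-\<^sup>1\<close> is equally invariant and
  \<open>|Ky\<^sup>-\<^sup>1 \<inter> A| = |K \<inter> Ay|\<close>.\<close>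

lemma sigma_up_le_upper_banach_density:
  assumes "group G" "folner_condition G" "A \<subseteq> carrier G"
  shows "sigma_up G A \<le> upper_banach_density G A"
proof -
  interpret group G by fact
  have bdd: "bdd_below ((\<lambda>F. SUP y\<in>carrier G. real (card (F \<inter> (A #>\<^bsub>G\<^esub> y))) / real (card F))
      ` fin_subsets G)"
    by (intro bdd_belowI2[of _ 0] cSUP_upper2[of _ _ "\<one>\<^bsub>G\<^esub>"] bdd_aboveI[of _ 1])
      (auto simp: fin_subsets_def card_Int_ratio_le_one)
  have attained: "\<exists>y\<in>carrier G. sigma_up G A \<le> real (card (K \<inter> (A #>\<^bsub>G\<^esub> y))) / real (card K)"
    if K: "K \<in> fin_subsets G" for K
  proof -
    have "finite K" "carrier G \<noteq> {}" using K by (auto simp: fin_subsets_def)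
    from sup_translate_density_attained[OF this, of "\<lambda>y. A #>\<^bsub>G\<^esub> y" "real (card K)"]
    obtain y where y: "y \<in> carrier G"
      "(SUP y\<in>carrier G. real (card (K \<inter> (A #>\<^bsub>G\<^esub> y))) / real (card K))
        = real (card (K \<inter> (A #>\<^bsub>G\<^esub> y))) / real (card K)" ..
    have "sigma_up G A \<le> real (card (K \<inter> (A #>\<^bsub>G\<^esub> y))) / real (card K)"
      using cINF_lower[OF bdd K] unfolding y(2) sigma_up_def .
    with y(1) show ?thesis ..
  qed
  have "banach_admissible G A (sigma_up G A)"
    unfolding banach_admissible_def
  proof (intro ballI allI impI)
    fix F and \<epsilon> :: real assume F: "F \<in> fin_subsets G" and "\<epsilon> > 0"
    then obtain K where K: "almost_invariant G F \<epsilon> K"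
      using assms(2) by (auto simp: folner_condition_def)
    then have KG: "K \<in> fin_subsets G" "K \<subseteq> carrier G"
      by (auto simp: almost_invariant_def fin_subsets_def)
    obtain y where y: "y \<in> carrier G"
      "sigma_up G A \<le> real (card (K \<inter> (A #>\<^bsub>G\<^esub> y))) / real (card K)"
      using attained[OF KG(1)] by blast
    define K' where "K' = K #>\<^bsub>G\<^esub> inv\<^bsub>G\<^esub> y"
    have K': "almost_invariant G F \<epsilon> K'" "card K' = card K"
      unfolding K'_def using almost_invariant_r_coset[OF _ K, of "inv\<^bsub>G\<^esub> y"] F y
      by (auto simp: fin_subsets_def)
    have "K \<inter> (A #>\<^bsub>G\<^esub> y) = (\<lambda>k. k \<otimes>\<^bsub>G\<^esub> y) ` (K' \<inter> A)"
    proof -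
      have "k \<in> K' \<longleftrightarrow> k \<otimes>\<^bsub>G\<^esub> y \<in> K" if "k \<in> carrier G" for k
        unfolding K'_def using mem_r_coset_inv_iff[OF KG(2) that y(1)] .
      then show ?thesis using assms(3) by (auto simp: r_coset_eq_image)
    qed
    then have "card (K \<inter> (A #>\<^bsub>G\<^esub> y)) \<le> card (K' \<inter> A)"
      using K'(1) by (auto simp: almost_invariant_def fin_subsets_def intro: card_image_le)
    then have "sigma_up G A \<le> real (card (K' \<inter> A)) / real (card K')"
      using y(2) K'(2) by (smt (verit) divide_right_mono of_nat_0_le_iff of_nat_mono)
    with K'(1) show "\<exists>K. almost_invariant G F \<epsilon> K
        \<and> sigma_up G A \<le> real (card (K \<inter> A)) / real (card K)" by blast
  qed
  moreover have "sigma_up G A \<in> {0..1}"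
  proof -
    have one: "{\<one>\<^bsub>G\<^esub>} \<in> fin_subsets G" by (simp add: fin_subsets_def)
    have "card ({\<one>\<^bsub>G\<^esub>} \<inter> B) \<le> 1" for B
      using card_mono[of "{\<one>\<^bsub>G\<^esub>}" "{\<one>\<^bsub>G\<^esub>} \<inter> B"] by simp
    then have "sigma_up G A \<le> 1" using attained[OF one] by (fastforce intro: order_trans)
    moreover have "0 \<le> sigma_up G A"
      unfolding sigma_up_def
    proof (rule cINF_greatest)
      show "fin_subsets G \<noteq> {}" using one by blast
      show "0 \<le> (SUP y\<in>carrier G. real (card (F \<inter> (A #>\<^bsub>G\<^esub> y))) / real (card F))"
        if "F \<in> fin_subsets G" for F
        using that
        by (intro cSUP_upper2[of _ _ "\<one>\<^bsub>G\<^esub>"] bdd_aboveI[of _ 1])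
          (auto simp: fin_subsets_def card_Int_ratio_le_one)
    qed
    ultimately show ?thesis by simp
  qed
  ultimately show ?thesis by (rule banach_admissible_le_upper_banach_density)
qed

text \<open>Subadditivity bounds every difference in the supremum by \<open>\<mu>(A)\<close>, and \<open>B = {}\<close> attains it.\<close>

lemma subadditivization_eq_self:
  assumes A: "A \<subseteq> carrier G" and "\<mu> {} = 0"
    and sub: "\<And>B. B \<subseteq> carrier G \<Longrightarrow> \<mu> (A \<union> B) \<le> \<mu> A + \<mu> B"
  shows "subadditivization G \<mu> A = \<mu> A"
  unfolding subadditivization_def
proof (rule cSup_eq_maximum)
  show "\<mu> A \<in> (\<lambda>B. \<mu> (A \<union> B) - \<mu> B) ` Pow (carrier G)"
    using \<open>\<mu> {} = 0\<close> by (intro image_eqI[of _ _ "{}"]) auto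
  fix v assume "v \<in> (\<lambda>B. \<mu> (A \<union> B) - \<mu> B) ` Pow (carrier G)"
  then obtain B where "B \<subseteq> carrier G" "v = \<mu> (A \<union> B) - \<mu> B" by blast
  then show "v \<le> \<mu> A" using sub[of B] by simp
qed

theorem theorem5p1:
  fixes G :: "('a, 'b) monoid_scheme" and A :: "'a set"
  assumes "amenable_group G"
    and "A \<subseteq> carrier G"
  shows "upper_banach_density G A = sigma_low G A
       \<and> sigma_low G A = sigma_up G A
       \<and> sigma_up G A = subadditivization G (sigma_low G) A
       \<and> subadditivization G (sigma_low G) A = subadditivization G (sigma_up G) A"
proof -
  have G: "group G" using assms(1) by (simp add: amenable_group_def)
  note folner = amenable_group_folner_condition[OF assms(1)]
  have eq: "sigma_low G B = upper_banach_density G B" "sigma_up G B = upper_banach_density G B"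
    if "B \<subseteq> carrier G" for B
    using upper_banach_density_le_sigma_low[OF G folner that] sigma_low_le_sigma_up[OF G, of B]
      sigma_up_le_upper_banach_density[OF G folner that] by simp_all
  have "carrier G \<noteq> {}" using G group.is_monoid monoid.one_closed by blast
  then obtain x where "x \<in> carrier G" by blast
  then have "return_pmf x \<in> fin_supp_pmfs G" by (simp add: fin_supp_pmfs_def)
  then have "fin_supp_pmfs G \<noteq> {}" by blast
  with \<open>carrier G \<noteq> {}\<close> have empty: "sigma_low G {} = 0" "sigma_up G {} = 0"
    using eq[of "{}"] by (simp_all add: sigma_low_def r_coset_def)
  have "subadditivization G (sigma_low G) A = sigma_low G A"
    using assms(2) empty upper_banach_density_subadditive[OF G folner]
    by (intro subadditivization_eq_self) (simp_all add: eq)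
  moreover have "subadditivization G (sigma_up G) A = sigma_up G A"
    using assms(2) empty upper_banach_density_subadditive[OF G folner]
    by (intro subadditivization_eq_self) (simp_all add: eq)
  ultimately show ?thesis using eq[OF assms(2)] by simp
qed

end
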